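(* Assume that the DA transition density $p(u,u')=\int_{S_V}\pi_{U|V}(u'|v)\pi_{V|U}(v|u)\,\nu(dv)$ satisfies $\int_{S_U}p(u,u)\,\mu(du)<\infty$. Let $r(v,\cdot)$, $v\in S_V$, be a Markov transition function on $S_V$ with invariant density $\pi_V$, let $\omega:S_V\to[0,\infty)$ be a probability density (with respect to $\nu$) that is positive almost everywhere, and let $(U^*,V^* )$ have joint density $$\eta(u,v)=\Big(\int_{S_V}\pi_{U|V}(u|v')\,r(v,dv')\Big)\,\omega(v)$$ with respect to $\mu\times\nu$. Then the variance $$D^2=\mathrm{var}\Big(\frac{\pi_{V|U}(V^*|U^* )}{\omega(V^* )}\Big)$$ is finite if $$\int_{S_V}\int_{S_U}\frac{\pi_{V|U}^3(v|u)\,\pi_{U|V}(u|v)}{\omega^2(v)}\,\mu(du)\,\nu(dv)<\infty .$$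
   Context: $(S_U,\mathcal{U},\mu)$ and $(S_V,\mathcal{V},\nu)$ are $\sigma$-finite measure spaces with $\mathcal{U}$ and $\mathcal{V}$ countably generated. $(U,V)$ is a random element of $S_U\times S_V$ with joint density $\pi_{U,V}$ with respect to $\mu\times\nu$ and marginal densities $\pi_U,\pi_V$; the conditional densities $\pi_{U|V}(u|v)=\pi_{U,V}(u,v)/\pi_V(v)$ and $\pi_{V|U}(v|u)=\pi_{U,V}(u,v)/\pi_U(u)$ are well defined almost everywhere on $S_U\times S_V$. A Markov transition function is a Markov (probability) kernel; $\pi_V$ is invariant for $r$ if $\int_{S_V}r(v,A)\pi_V(v)\,\nu(dv)=\int_A\pi_V\,d\nu$ for all $A\in\mathcal{V}$. The Markov chain with transition density $p$ is assumed Harris ergodic (irreducible, aperiodic, Harris recurrent). *)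

theory Defs
  imports "HOL-Probability.Probability"
begin

definition countably_generated :: "'a measure \<Rightarrow> bool" where
  "countably_generated M \<longleftrightarrow>
     (\<exists>C. countable C \<and> C \<subseteq> Pow (space M) \<and> sets M = sigma_sets (space M) C)"

abbreviation markov_kernel :: "'a measure \<Rightarrow> ('a \<Rightarrow> 'a measure) \<Rightarrow> bool" where
  "markov_kernel M K \<equiv> K \<in> M \<rightarrow>\<^sub>M prob_algebra M"

definition invariant_density :: "'a measure \<Rightarrow> ('a \<Rightarrow> 'a measure) \<Rightarrow> ('a \<Rightarrow> real) \<Rightarrow> bool" where
  "invariant_density M K f \<longleftrightarrow>
     (\<forall>A\<in>sets M. (\<integral>\<^sup>+x. emeasure (K x) A * ennreal (f x) \<partial>M) = (\<integral>\<^sup>+x\<in>A. ennreal (f x) \<partial>M))"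



text \<open>The chain is realised on its canonical path space: \<open>path_law M K x\<close> is the law of
  \<open>(X\<^sub>0, X\<^sub>1, \<dots>)\<close> started at \<open>X\<^sub>0 = x\<close>, obtained from the Ionescu-Tulcea theorem; the step to
  \<open>X\<^sub>n\<close> sees the history only through \<open>X\<^bsub>n - 1\<^esub>\<close>.\<close>

definition chain_step :: "'a measure \<Rightarrow> ('a \<Rightarrow> 'a measure) \<Rightarrow> 'a \<Rightarrow> nat \<Rightarrow> (nat \<Rightarrow> 'a) \<Rightarrow> 'a measure" where
  "chain_step M K x n h = (if n = 0 then return M x else K (h (n - 1)))"

lemma Ionescu_Tulcea_chain_step:
  assumes K: "markov_kernel M K" and x: "x \<in> space M"
  shows "Ionescu_Tulcea (chain_step M K x) (\<lambda>_. M)"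
proof (rule Ionescu_Tulcea.intro, goal_cases)
  case (1 n)
  show ?case
  proof (cases "n = 0")
    case True
    have "return M x \<in> space (subprob_algebra M)"
      using measurable_space [OF return_measurable x] .
    with True show ?thesis by (simp add: chain_step_def [abs_def])
  next
    case False
    then have "(\<lambda>h. h (n - 1)) \<in> PiM {0..<n} (\<lambda>_. M) \<rightarrow>\<^sub>M M"
      by (intro measurable_component_singleton) auto
    from measurable_compose [OF this measurable_prob_algebraD [OF K]] False
    show ?thesis by (simp add: chain_step_def [abs_def])
  qed
next
  case (2 n h)
  show ?case
  proof (cases "n = 0")
    case True
    then show ?thesis using x by (simp add: chain_step_def prob_space_return)
  next
    case False
    with 2 have "h (n - 1) \<in> space M" by (auto simp: space_PiM PiE_iff)
    from measurable_space [OF K this] False show ?thesis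
      by (simp add: chain_step_def space_prob_algebra)
  qed
qed

definition path_law :: "'a measure \<Rightarrow> ('a \<Rightarrow> 'a measure) \<Rightarrow> 'a \<Rightarrow> (nat \<Rightarrow> 'a) measure" where
  "path_law M K x =
     projective_family.lim UNIV (Ionescu_Tulcea.CI (chain_step M K x) (\<lambda>_. M)) (\<lambda>_. M)"

definition return_prob :: "'a measure \<Rightarrow> ('a \<Rightarrow> 'a measure) \<Rightarrow> 'a \<Rightarrow> 'a set \<Rightarrow> ennreal" where
  "return_prob M K x A =
     emeasure (path_law M K x) {X \<in> space (\<Pi>\<^sub>M n\<in>UNIV. M). \<exists>n\<ge>1. X n \<in> A}"

definition infinitely_often_prob :: "'a measure \<Rightarrow> ('a \<Rightarrow> 'a measure) \<Rightarrow> 'a \<Rightarrow> 'a set \<Rightarrow> ennreal" where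
  "infinitely_often_prob M K x A =
     emeasure (path_law M K x) {X \<in> space (\<Pi>\<^sub>M n\<in>UNIV. M). \<exists>\<^sub>\<infinity>n. X n \<in> A}"

text \<open>Irreducibility, periodicity and Harris recurrence are as in Meyn and Tweedie,
  \<^emph>\<open>Markov Chains and Stochastic Stability\<close>.\<close>

definition irreducibility_measure :: "'a measure \<Rightarrow> ('a \<Rightarrow> 'a measure) \<Rightarrow> 'a measure \<Rightarrow> bool" where
  "irreducibility_measure M K \<phi> \<longleftrightarrow>
     sets \<phi> = sets M \<and> sigma_finite_measure \<phi> \<and> emeasure \<phi> (space M) \<noteq> 0 \<and>
     (\<forall>A\<in>sets M. emeasure \<phi> A > 0 \<longrightarrow> (\<forall>x\<in>space M. return_prob M K x A > 0))"

definition maximal_irreducibility_measure ::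
    "'a measure \<Rightarrow> ('a \<Rightarrow> 'a measure) \<Rightarrow> 'a measure \<Rightarrow> bool" where
  "maximal_irreducibility_measure M K \<psi> \<longleftrightarrow>
     irreducibility_measure M K \<psi> \<and>
     (\<forall>\<phi>. irreducibility_measure M K \<phi> \<longrightarrow> absolutely_continuous \<psi> \<phi>)"

definition cycle_of_length ::
    "'a measure \<Rightarrow> ('a \<Rightarrow> 'a measure) \<Rightarrow> 'a measure \<Rightarrow> nat \<Rightarrow> (nat \<Rightarrow> 'a set) \<Rightarrow> bool" where
  "cycle_of_length M K \<psi> d D \<longleftrightarrow>
     (\<forall>i<d. D i \<in> sets M) \<and> disjoint_family_on D {..<d} \<and>
     (\<forall>i<d. \<forall>x\<in>D i. emeasure (K x) (D (Suc i mod d)) = 1) \<and>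
     emeasure \<psi> (space M - (\<Union>i<d. D i)) = 0"

definition harris_ergodic :: "'a measure \<Rightarrow> ('a \<Rightarrow> 'a measure) \<Rightarrow> bool" where
  "harris_ergodic M K \<longleftrightarrow>
     (\<exists>\<psi>. maximal_irreducibility_measure M K \<psi> \<and>
          \<not> (\<exists>d\<ge>2. \<exists>D. cycle_of_length M K \<psi> d D) \<and>
          (\<forall>A\<in>sets M. emeasure \<psi> A > 0 \<longrightarrow> (\<forall>x\<in>A. infinitely_often_prob M K x A = 1)))"



text \<open>In the following, \<open>f\<close> is the joint density \<open>\<pi>\<^bsub>U,V\<^esub>\<close>, and \<open>fU\<close>, \<open>fV\<close> are its marginal
  densities. Where a marginal density vanishes, the conditional density is 0 because \<open>x / 0 = 0\<close>.\<close>

definition cond_U :: "('u \<Rightarrow> 'v \<Rightarrow> real) \<Rightarrow> ('v \<Rightarrow> real) \<Rightarrow> 'u \<Rightarrow> 'v \<Rightarrow> real" where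
  "cond_U f fV u v = f u v / fV v"

definition cond_V :: "('u \<Rightarrow> 'v \<Rightarrow> real) \<Rightarrow> ('u \<Rightarrow> real) \<Rightarrow> 'v \<Rightarrow> 'u \<Rightarrow> real" where
  "cond_V f fU v u = f u v / fU u"

definition da_density ::
    "'v measure \<Rightarrow> ('u \<Rightarrow> 'v \<Rightarrow> real) \<Rightarrow> ('u \<Rightarrow> real) \<Rightarrow> ('v \<Rightarrow> real) \<Rightarrow> 'u \<Rightarrow> 'u \<Rightarrow> ennreal" where
  "da_density N f fU fV u u' = (\<integral>\<^sup>+v. ennreal (cond_U f fV u' v * cond_V f fU v u) \<partial>N)"

definition eta_density ::
    "('u \<Rightarrow> 'v \<Rightarrow> real) \<Rightarrow> ('v \<Rightarrow> real) \<Rightarrow> ('v \<Rightarrow> 'v measure) \<Rightarrow> ('v \<Rightarrow> real) \<Rightarrow> 'u \<Rightarrow> 'v \<Rightarrow> ennreal" where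
  "eta_density f fV r w u v = (\<integral>\<^sup>+v'. ennreal (cond_U f fV u v') \<partial>r v) * ennreal (w v)"

text \<open>The library's \<open>prob_space.variance\<close> is real-valued and hence finite by totality; this
  version can be infinite. It is meaningful only when \<open>X\<close> has a mean, i.e. is integrable.\<close>

definition ext_variance :: "'a measure \<Rightarrow> ('a \<Rightarrow> real) \<Rightarrow> ennreal" where
  "ext_variance M X = (\<integral>\<^sup>+z. ennreal ((X z - integral\<^sup>L M X)\<^sup>2) \<partial>M)"

definition finite_variance :: "'a measure \<Rightarrow> ('a \<Rightarrow> real) \<Rightarrow> bool" where
  "finite_variance M X \<longleftrightarrow> integrable M X \<and> ext_variance M X < \<infinity>"

end

theory Submission
  imports Defs
begin

text \<open>Write \<open>g\<close> and \<open>h\<close> for the conditional densities of \<open>V\<close> given \<open>U\<close> and of \<open>U\<close> given \<open>V\<close>,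
  and \<open>R\<close> for the operator of the kernel \<open>r\<close>. The second moment is the integral of
  \<open>g\<^sup>2 R h / \<omega>\<close>. Since \<open>h = g fU / fV\<close>, AM-GM bounds the integrand by
  \<open>g\<^sup>3 h / \<omega>\<^sup>2 + (fV / fU) (R h)\<^sup>2\<close>. The first term is the moment hypothesis. In the second,
  \<open>(R h)\<^sup>2 \<le> R (h\<^sup>2)\<close> and invariance of \<open>fV\<close> lead to the integral of \<open>(fV / fU) h\<^sup>2 = g h\<close>, which is
  the trace.\<close>

text \<open>Cauchy-Schwarz against the constant 1, whose square has integral 1 under a probability
  measure. It is applied below to the measures \<open>r v\<close>.\<close>

lemma nn_integral_square_le:
  assumes "prob_space M" and [measurable]: "h \<in> borel_measurable M"
  shows "(\<integral>\<^sup>+x. h x \<partial>M)\<^sup>2 \<le> (\<integral>\<^sup>+x. (h x)\<^sup>2 \<partial>M)"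
  using Cauchy_Schwarz_nn_integral[of h M "\<lambda>_. 1"] prob_space.emeasure_space_1[OF assms(1)]
  by simp

text \<open>Invariance is given on sets only. It says that the measure \<open>?D\<close> with
  density \<open>p\<close> is a fixed point of \<open>bind\<close> with \<open>K\<close>;
  integrating \<open>k\<close> against both sides extends it to nonnegative measurable
  functions.\<close>

lemma invariant_density_nn_integral:
  assumes K: "markov_kernel N K" and inv: "invariant_density N K p"
    and p [measurable]: "(\<lambda>x. ennreal (p x)) \<in> borel_measurable N"
    and prob: "prob_space (density N (\<lambda>x. ennreal (p x)))"
    and k [measurable]: "k \<in> borel_measurable N"
  shows "(\<integral>\<^sup>+x. ennreal (p x) * (\<integral>\<^sup>+y. k y \<partial>K x) \<partial>N) = (\<integral>\<^sup>+x. ennreal (p x) * k x \<partial>N)"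
proof -
  let ?D = "density N (\<lambda>x. ennreal (p x))"
  \<comment> \<open>On an empty space \<open>bind\<close> takes a default value, so its rules ask
    for nonemptiness; this is where \<open>prob\<close> enters.\<close>
  have ne: "space ?D \<noteq> {}"
    using prob_space.not_empty[OF prob] .
  have K' [measurable]: "K \<in> N \<rightarrow>\<^sub>M subprob_algebra N"
    using measurable_prob_algebraD[OF K] .
  have KD: "K \<in> ?D \<rightarrow>\<^sub>M subprob_algebra N"
    by simp
  have sets_bind_eq: "sets (?D \<bind> K) = sets N"
    by (rule sets_bind[OF sets_kernel[OF KD] ne])
  have "?D \<bind> K = ?D"
  proof (rule measure_eqI)
    fix A assume "A \<in> sets (?D \<bind> K)"
    then have A [measurable]: "A \<in> sets N"
      using sets_bind_eq by simp
    have "emeasure (?D \<bind> K) A = (\<integral>\<^sup>+x. emeasure (K x) A \<partial>?D)"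
      by (rule emeasure_bind[OF ne KD A])
    also have "\<dots> = (\<integral>\<^sup>+x. emeasure (K x) A * ennreal (p x) \<partial>N)"
      by (subst nn_integral_density) (auto simp: mult.commute)
    also have "\<dots> = emeasure ?D A"
      using inv by (simp add: invariant_density_def emeasure_density)
    finally show "emeasure (?D \<bind> K) A = emeasure ?D A" .
  qed (simp add: sets_bind_eq)
  moreover have "(\<integral>\<^sup>+x. k x \<partial>(?D \<bind> K)) = (\<integral>\<^sup>+x. \<integral>\<^sup>+y. k y \<partial>K x \<partial>?D)"
    by (rule nn_integral_bind[OF k KD])
  ultimately have "(\<integral>\<^sup>+x. k x \<partial>?D) = (\<integral>\<^sup>+x. \<integral>\<^sup>+y. k y \<partial>K x \<partial>?D)"
    by simp
  then show ?thesis
    by (simp add: nn_integral_density)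
qed

text \<open>Here \<open>a\<close>, \<open>b\<close>, \<open>t\<close> stand for \<open>fU u\<close>,
  \<open>fV v\<close> and the kernel average of \<open>cond_U\<close>. For finite
  \<open>t = s\<close>, put \<open>y = g\<^sup>2 / w\<close> and \<open>c = b / a\<close>: the left
  side is \<open>y * s\<close>, the right side is \<open>(y\<^sup>2 + (c * s)\<^sup>2) / c\<close>,
  and AM-GM compares them.\<close>

lemma second_moment_integrand_le:
  fixes f a b w :: real and t :: ennreal
  assumes f: "0 \<le> f" and a: "0 < a" and b: "0 < b" and w: "0 < w"
  shows "t * ennreal w * ennreal ((f / a / w)\<^sup>2)
    \<le> ennreal ((f / a) ^ 3 * (f / b) / w\<^sup>2) + ennreal (b / a) * t\<^sup>2"
proof (cases t)
  \<comment> \<open>Since \<open>b / a\<close> is positive, the right side is infinite.\<close>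
  case top
  then show ?thesis
    using a b by (simp add: ennreal_mult_top power2_eq_square)
next
  case (real s)
  define g c where "g = f / a" and "c = b / a"
  have pos: "0 \<le> g" "0 < c" using f a b by (auto simp: g_def c_def)
  define y where "y = g\<^sup>2 / w"
  have y: "0 \<le> y" using w by (simp add: y_def)
  have fb: "f / b = g / c" using a b by (simp add: g_def c_def)
  \<comment> \<open>AM-GM bounds twice the left side; nonnegativity allows the factor 2 to be
    dropped.\<close>
  have "c * (y * s) \<le> y\<^sup>2 + (c * s)\<^sup>2"
  proof -
    have "0 \<le> c * (y * s)" using pos y real by simp
    then show ?thesis using sum_squares_bound[of y "c * s"] by (simp add: algebra_simps)
  qed
  then have "y * s \<le> (y\<^sup>2 + (c * s)\<^sup>2) / c"
    using pos by (simp add: pos_le_divide_eq mult.commute)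
  also have "\<dots> = y\<^sup>2 / c + c * s\<^sup>2"
    using pos by (simp add: field_simps power2_eq_square)
  also have "y\<^sup>2 / c = g ^ 3 * (g / c) / w\<^sup>2"
    by (simp add: y_def power_divide power2_eq_square power3_eq_cube mult_ac)
  finally have main: "s * w * (g / w)\<^sup>2 \<le> g ^ 3 * (g / c) / w\<^sup>2 + c * s\<^sup>2"
    using w by (simp add: y_def power2_eq_square field_simps)
  have "t * ennreal w * ennreal ((f / a / w)\<^sup>2) = ennreal (s * w * (g / w)\<^sup>2)"
    using real w by (simp add: g_def ennreal_mult)
  also have "\<dots> \<le> ennreal (g ^ 3 * (g / c) / w\<^sup>2 + c * s\<^sup>2)"
    by (rule ennreal_leI[OF main])
  also have "\<dots> = ennreal ((f / a) ^ 3 * (f / b) / w\<^sup>2) + ennreal (b / a) * t\<^sup>2"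
    using real pos w by (simp add: fb ennreal_plus ennreal_mult ennreal_power flip: g_def c_def)
  finally show ?thesis .
qed

text \<open>On a probability space square integrability implies integrability, so the mean exists
  before the centred square is expanded.\<close>

lemma finite_varianceI:
  assumes "prob_space Q" and X [measurable]: "X \<in> borel_measurable Q"
    and fin: "(\<integral>\<^sup>+z. ennreal ((X z)\<^sup>2) \<partial>Q) < \<infinity>"
  shows "finite_variance Q X"
proof -
  interpret prob_space Q by fact
  have sq: "integrable Q (\<lambda>z. (X z)\<^sup>2)"
    using fin by (intro integrableI_nonneg) auto
  have int: "integrable Q X"
    by (rule square_integrable_imp_integrable[OF X sq])
  have "integrable Q (\<lambda>z. (X z - expectation X)\<^sup>2)"
    using sq int by (simp add: power2_diff)
  then have "ext_variance Q X < \<infinity>"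
    by (simp add: ext_variance_def integrable_iff_bounded)
  with int show ?thesis
    by (simp add: finite_variance_def)
qed

theorem theorem4:
  fixes M :: "'u measure" and N :: "'v measure"
    and P :: "'a measure" and U :: "'a \<Rightarrow> 'u" and V :: "'a \<Rightarrow> 'v"
    and f :: "'u \<Rightarrow> 'v \<Rightarrow> real" and fU :: "'u \<Rightarrow> real" and fV :: "'v \<Rightarrow> real"
    and K :: "'u \<Rightarrow> 'u measure" and r :: "'v \<Rightarrow> 'v measure" and \<omega> :: "'v \<Rightarrow> real"
    and Q :: "'b measure" and Us :: "'b \<Rightarrow> 'u" and Vs :: "'b \<Rightarrow> 'v"
  assumes "sigma_finite_measure M" and "countably_generated M"
    and "sigma_finite_measure N" and "countably_generated N"
    and "prob_space P"
    and f_nonneg: "\<And>u v. u \<in> space M \<Longrightarrow> v \<in> space N \<Longrightarrow> 0 \<le> f u v"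
    and fU_nonneg: "\<And>u. u \<in> space M \<Longrightarrow> 0 \<le> fU u"
    and fV_nonneg: "\<And>v. v \<in> space N \<Longrightarrow> 0 \<le> fV v"
    and joint_density: "distributed P (M \<Otimes>\<^sub>M N) (\<lambda>z. (U z, V z)) (\<lambda>(u, v). ennreal (f u v))"
    and marginal_U: "distributed P M U (\<lambda>u. ennreal (fU u))"
    and marginal_V: "distributed P N V (\<lambda>v. ennreal (fV v))"
    and conditionals_defined: "AE (u, v) in M \<Otimes>\<^sub>M N. fU u > 0 \<and> fV v > 0"
    and chain: "markov_kernel M K" "AE u in M. K u = density M (da_density N f fU fV u)"
      "harris_ergodic M K"
    and trace_class: "(\<integral>\<^sup>+u. da_density N f fU fV u u \<partial>M) < \<infinity>"
    and r: "markov_kernel N r" "invariant_density N r fV"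
    and \<omega>: "\<omega> \<in> borel_measurable N" "\<And>v. v \<in> space N \<Longrightarrow> 0 \<le> \<omega> v"
      "(\<integral>\<^sup>+v. ennreal (\<omega> v) \<partial>N) = 1" "AE v in N. \<omega> v > 0"
    and "prob_space Q"
    and star_density:
      "distributed Q (M \<Otimes>\<^sub>M N) (\<lambda>z. (Us z, Vs z)) (\<lambda>(u, v). eta_density f fV r \<omega> u v)"
    and moment: "(\<integral>\<^sup>+v. \<integral>\<^sup>+u. ennreal ((cond_V f fU v u)^3 * cond_U f fV u v / (\<omega> v)^2) \<partial>M \<partial>N) < \<infinity>"
  shows "finite_variance Q (\<lambda>z. cond_V f fU (Vs z) (Us z) / \<omega> (Vs z))"
proof -
  interpret M: sigma_finite_measure M by fact
  interpret N: sigma_finite_measure N by fact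
  interpret pair_sigma_finite M N ..
  interpret P: prob_space P by fact
  let ?h = "cond_U f fV" and ?g = "cond_V f fU"
  \<comment> \<open>\<open>distributed\<close> yields measurability only of the
    \<open>ennreal\<close> version; \<open>enn2real\<close> recovers the real density on the space,
    where it is nonnegative. The marginals are treated alike.\<close>
  have "(\<lambda>(u, v). ennreal (f u v)) \<in> borel_measurable (M \<Otimes>\<^sub>M N)"
    using joint_density by (rule distributed_borel_measurable)
  then have "(\<lambda>z. enn2real (case z of (u, v) \<Rightarrow> ennreal (f u v))) \<in> borel_measurable (M \<Otimes>\<^sub>M N)"
    by measurable
  then have f [measurable]: "case_prod f \<in> borel_measurable (M \<Otimes>\<^sub>M N)"
    by (rule measurable_cong[THEN iffD1, rotated]) (auto simp: space_pair_measure f_nonneg)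
  have fU_enn: "(\<lambda>u. ennreal (fU u)) \<in> borel_measurable M"
    using marginal_U by (rule distributed_borel_measurable)
  then have "(\<lambda>u. enn2real (ennreal (fU u))) \<in> borel_measurable M"
    by measurable
  then have fU [measurable]: "fU \<in> borel_measurable M"
    by (rule measurable_cong[THEN iffD1, rotated]) (auto simp: fU_nonneg)
  have fV_enn: "(\<lambda>v. ennreal (fV v)) \<in> borel_measurable N"
    using marginal_V by (rule distributed_borel_measurable)
  then have "(\<lambda>v. enn2real (ennreal (fV v))) \<in> borel_measurable N"
    by measurable
  then have fV [measurable]: "fV \<in> borel_measurable N"
    by (rule measurable_cong[THEN iffD1, rotated]) (auto simp: fV_nonneg)
  have [measurable]: "\<omega> \<in> borel_measurable N"
    by fact
  have [measurable]: "(\<lambda>(u, v). ?h u v) \<in> borel_measurable (M \<Otimes>\<^sub>M N)"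
    unfolding cond_U_def by measurable
  have [measurable]: "(\<lambda>(u, v). ?g v u) \<in> borel_measurable (M \<Otimes>\<^sub>M N)"
    unfolding cond_V_def by measurable
  have [measurable]: "r \<in> N \<rightarrow>\<^sub>M subprob_algebra N"
    using measurable_prob_algebraD[OF r(1)] .
  have prob_V: "prob_space (density N (\<lambda>v. ennreal (fV v)))"
    using P.prob_space_distr[OF distributed_measurable[OF marginal_V]]
      distributed_distr_eq_density[OF marginal_V] by simp
  have r_prob: "prob_space (r v)" and r_sets: "sets (r v) = sets N" if "v \<in> space N" for v
    using measurable_space[OF r(1) that] by (auto simp: space_prob_algebra)

  define R where "R u v = (\<integral>\<^sup>+v'. ennreal (?h u v') \<partial>r v)" for u v
  have R [measurable]: "(\<lambda>(u, v). R u v) \<in> borel_measurable (M \<Otimes>\<^sub>M N)"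
  proof -
    \<comment> \<open>The integrand depends on \<open>u\<close> and the measure on \<open>v\<close>,
      so the whole pair \<open>z\<close> is taken as the kernel parameter.\<close>
    have "(\<lambda>z. \<integral>\<^sup>+v'. (\<lambda>(z, v'). ennreal (?h (fst z) v')) (z, v') \<partial>r (snd z))
        \<in> borel_measurable (M \<Otimes>\<^sub>M N)"
      by (rule nn_integral_measurable_subprob_algebra2[where N = N]) measurable
    then show ?thesis
      by (simp add: R_def case_prod_beta)
  qed

  have R_le: "(\<integral>\<^sup>+u. \<integral>\<^sup>+v. ennreal (fV v / fU u) * (R u v)\<^sup>2 \<partial>N \<partial>M)
      \<le> (\<integral>\<^sup>+u. da_density N f fU fV u u \<partial>M)"
  proof (rule nn_integral_mono)
    fix u assume u [measurable]: "u \<in> space M"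
    have h_u [measurable]: "(\<lambda>v. ?h u v) \<in> borel_measurable N"
      by measurable
    have sq: "(R u v)\<^sup>2 \<le> (\<integral>\<^sup>+v'. (ennreal (?h u v'))\<^sup>2 \<partial>r v)" if "v \<in> space N" for v
      unfolding R_def
    proof (rule nn_integral_square_le[OF r_prob[OF that]])
      show "(\<lambda>v'. ennreal (?h u v')) \<in> borel_measurable (r v)"
        unfolding measurable_cong_sets[OF r_sets[OF that] refl] by measurable
    qed
    have [measurable]:
      "(\<lambda>v. \<integral>\<^sup>+v'. (ennreal (?h u v'))\<^sup>2 \<partial>r v) \<in> borel_measurable N"
      by (rule nn_integral_measurable_subprob_algebra2[where N = N]) measurable
    have split: "ennreal (fV v / fU u) = ennreal (1 / fU u) * ennreal (fV v)"
      if "v \<in> space N" for v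
      using fU_nonneg[OF u] fV_nonneg[OF that] by (simp flip: ennreal_mult)
    have "(\<integral>\<^sup>+v. ennreal (fV v / fU u) * (R u v)\<^sup>2 \<partial>N)
        \<le> (\<integral>\<^sup>+v. ennreal (1 / fU u) *
              (ennreal (fV v) * (\<integral>\<^sup>+v'. (ennreal (?h u v'))\<^sup>2 \<partial>r v)) \<partial>N)"
      by (rule nn_integral_mono) (simp add: split mult.assoc mult_left_mono sq)
    also have "\<dots> = ennreal (1 / fU u) *
        (\<integral>\<^sup>+v. ennreal (fV v) * (\<integral>\<^sup>+v'. (ennreal (?h u v'))\<^sup>2 \<partial>r v) \<partial>N)"
      by (rule nn_integral_cmult) measurable
    \<comment> \<open>With \<open>u\<close> fixed, invariance of \<open>fV\<close> removes the
      kernel; the weight \<open>1 / fU u\<close> is constant in \<open>v\<close> and had to be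
      pulled out first.\<close>
    also have "\<dots> = ennreal (1 / fU u) * (\<integral>\<^sup>+v. ennreal (fV v) * (ennreal (?h u v))\<^sup>2 \<partial>N)"
      by (subst invariant_density_nn_integral[OF r fV_enn prob_V]) simp_all
    also have "\<dots> = (\<integral>\<^sup>+v. ennreal (1 / fU u) * (ennreal (fV v) * (ennreal (?h u v))\<^sup>2) \<partial>N)"
      by (rule nn_integral_cmult[symmetric]) measurable
    also have "\<dots> = da_density N f fU fV u u"
      unfolding da_density_def
    proof (rule nn_integral_cong)
      fix v assume v: "v \<in> space N"
      \<comment> \<open>Both sides are \<open>(f u v)\<^sup>2 / (fU u * fV v)\<close>. By
        \<open>x / 0 = 0\<close> this also holds where a marginal vanishes, so \<open>R_le\<close>
        has no exceptional set.\<close>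
      have "1 / fU u * (fV v * (?h u v)\<^sup>2) = ?h u v * ?g v u"
        by (simp add: cond_U_def cond_V_def power2_eq_square)
      then show "ennreal (1 / fU u) * (ennreal (fV v) * (ennreal (?h u v))\<^sup>2)
          = ennreal (?h u v * ?g v u)"
        using fU_nonneg[OF u] fV_nonneg[OF v] f_nonneg[OF u v]
        by (simp add: ennreal_power cond_U_def flip: ennreal_mult)
    qed
    finally show "(\<integral>\<^sup>+v. ennreal (fV v / fU u) * (R u v)\<^sup>2 \<partial>N) \<le> da_density N f fU fV u u" .
  qed

  let ?F = "\<lambda>u v. ennreal ((?g v u) ^ 3 * ?h u v / (\<omega> v)\<^sup>2)"
  let ?G = "\<lambda>u v. ennreal (fV v / fU u) * (R u v)\<^sup>2"
  let ?X = "\<lambda>z. ?g (snd z) (fst z) / \<omega> (snd z)"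
  have X: "?X \<in> borel_measurable (M \<Otimes>\<^sub>M N)"
    by measurable
  \<comment> \<open>The pointwise bound divides by both marginals, so it is claimed only where they
    are positive.\<close>
  have AE_le: "AE z in M \<Otimes>\<^sub>M N. (case z of (u, v) \<Rightarrow> eta_density f fV r \<omega> u v) * ennreal ((?X z)\<^sup>2)
      \<le> (case z of (u, v) \<Rightarrow> ?F u v) + (case z of (u, v) \<Rightarrow> ?G u v)"
    using conditionals_defined AE_space
  proof eventually_elim
    case (elim z)
    obtain u v where z: "z = (u, v)" by (cases z)
    with elim have uv: "u \<in> space M" "v \<in> space N" and pos: "0 < fU u" "0 < fV v"
      by (auto simp: space_pair_measure)
    show ?case
    \<comment> \<open>If \<open>\<omega> v = 0\<close>, the quotient \<open>?X z\<close> is 0 by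
      \<open>x / 0 = 0\<close> and the left side vanishes.\<close>
    proof (cases "\<omega> v = 0")
      case False
      then have "0 < \<omega> v" using \<omega>(2)[OF uv(2)] by simp
      from second_moment_integrand_le[OF f_nonneg[OF uv] pos this, of "R u v"]
      show ?thesis
        by (simp add: z eta_density_def R_def cond_V_def cond_U_def)
    qed (simp add: z)
  qed
  have "(\<integral>\<^sup>+z. ennreal ((?g (Vs z) (Us z) / \<omega> (Vs z))\<^sup>2) \<partial>Q)
      = (\<integral>\<^sup>+z. (case z of (u, v) \<Rightarrow> eta_density f fV r \<omega> u v) * ennreal ((?X z)\<^sup>2) \<partial>(M \<Otimes>\<^sub>M N))"
    by (subst distributed_nn_integral[OF star_density]) simp_all
  also have "\<dots> \<le> (\<integral>\<^sup>+z. (case z of (u, v) \<Rightarrow> ?F u v) + (case z of (u, v) \<Rightarrow> ?G u v) \<partial>(M \<Otimes>\<^sub>M N))"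
    by (rule nn_integral_mono_AE[OF AE_le])
  also have "\<dots> = (\<integral>\<^sup>+z. (case z of (u, v) \<Rightarrow> ?F u v) \<partial>(M \<Otimes>\<^sub>M N))
      + (\<integral>\<^sup>+z. (case z of (u, v) \<Rightarrow> ?G u v) \<partial>(M \<Otimes>\<^sub>M N))"
    by (rule nn_integral_add) measurable
  \<comment> \<open>Tonelli is used in opposite orders: \<open>moment\<close> has the inner integral
    over \<open>u\<close>, while \<open>R_le\<close> has it over \<open>v\<close>, the variable in
    which invariance acts.\<close>
  also have "(\<integral>\<^sup>+z. (case z of (u, v) \<Rightarrow> ?F u v) \<partial>(M \<Otimes>\<^sub>M N)) = (\<integral>\<^sup>+v. \<integral>\<^sup>+u. ?F u v \<partial>M \<partial>N)"
    by (subst nn_integral_snd[symmetric]) simp_all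
  also have "(\<integral>\<^sup>+z. (case z of (u, v) \<Rightarrow> ?G u v) \<partial>(M \<Otimes>\<^sub>M N)) = (\<integral>\<^sup>+u. \<integral>\<^sup>+v. ?G u v \<partial>N \<partial>M)"
    by (subst N.nn_integral_fst[symmetric]) simp_all
  also have "(\<integral>\<^sup>+v. \<integral>\<^sup>+u. ?F u v \<partial>M \<partial>N) + (\<integral>\<^sup>+u. \<integral>\<^sup>+v. ?G u v \<partial>N \<partial>M) < \<infinity>"
    using moment le_less_trans[OF R_le trace_class] by simp
  finally have "(\<integral>\<^sup>+z. ennreal ((?g (Vs z) (Us z) / \<omega> (Vs z))\<^sup>2) \<partial>Q) < \<infinity>" .
  moreover have "(\<lambda>z. ?g (Vs z) (Us z) / \<omega> (Vs z)) \<in> borel_measurable Q"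
    using measurable_compose[OF distributed_measurable[OF star_density] X] by simp
  ultimately show ?thesis
    using finite_varianceI[OF \<open>prob_space Q\<close>] by blast
qed

end
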